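(* For every integer $n\ge1$, the expectation of the number $X_n$ of swaps of Quicksort for a list of length $n$ under Variant IV is $$E[X_n]=(n+2)H_1(n)-\frac52 n-\frac12.$$
   Context: $H_1(n)=\sum_{i=1}^n \frac1i$. Variant IV is in-place Quicksort, applied to a uniformly random ordering of $n$ distinct elements, in which no element is swapped with itself. To partition a list $S$ of length $n\ge 2$: pivot $:=S[n]$, $i:=1$; for $j$ from $1$ to $n-1$, if $S[j]\le$ pivot then (swap $S[i]$ with $S[j]$ only if $i\ne j$) and set $i:=i+1$; finally, if $i\ne n$, swap $S[i]$ with $S[n]$. Then recurse on the sublists before and after position $i$; lists of length at most $1$ require nothing. $X_n$ is the total number of swaps performed. Formally, the probability generating function $P_n(t)=\sum_{m\ge0}P(X_n=m)t^m$ is determined by $P_0(t)=P_1(t)=1$ and, for $n\ge2$, $P_n(t)=\frac1n\sum_{k=1}^nP_{k-1}(t)P_{n-k}(t)\,Q(n,k,t)$, where $Q(n,n,t)=1$ and $Q(n,k,t)=\sum_{s=1}^k\frac{n-k}{n-1}\,\frac{\binom{k-1}{k-s}}{\binom{n-2}{k-s}}\,t^s$ for $k<n$. *)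

theory Defs
  imports "HOL-Probability.Probability" "HOL-Combinatorics.Multiset_Permutations"
begin

text \<open>
  In-place Quicksort (last element as pivot) that never swaps an element with itself,
  instrumented with a counter for the swaps performed. List positions start at 0.
\<close>

definition swap_at :: "'a list \<Rightarrow> nat \<Rightarrow> nat \<Rightarrow> 'a list" where
  "swap_at S i j = S[i := S ! j, j := S ! i]"

text \<open>One round of the partitioning loop; the state is (list, \<open>i\<close>, number of swaps so far).\<close>

definition part_step :: "'a::linorder \<Rightarrow> nat \<Rightarrow> 'a list \<times> nat \<times> nat \<Rightarrow> 'a list \<times> nat \<times> nat" where
  "part_step pivot j = (\<lambda>(S, i, c).
     if S ! j \<le> pivot
     then (if i \<noteq> j then (swap_at S i j, Suc i, Suc c) else (S, Suc i, c))
     else (S, i, c))"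

definition partition_in_place :: "'a::linorder list \<Rightarrow> 'a list \<times> nat \<times> nat" where
  "partition_in_place S =
     (let n = length S;
          (T, i, c) = fold (part_step (S ! (n - 1))) [0..<n - 1] (S, 0, 0)
      in if i \<noteq> n - 1 then (swap_at T i (n - 1), i, Suc c) else (T, i, c))"

lemma fold_part_step_bounds:
  "fold (part_step p) js (S, i, c) = (T, i', c') \<Longrightarrow> length T = length S \<and> i' \<le> i + length js"
proof (induction js arbitrary: S i c)
  case (Cons j js)
  obtain S1 i1 c1 where st: "part_step p j (S, i, c) = (S1, i1, c1)"
    by (cases "part_step p j (S, i, c)")
  then have "length S1 = length S \<and> i1 \<le> Suc i"
    by (auto simp: part_step_def swap_at_def split: if_splits)
  moreover have "length T = length S1 \<and> i' \<le> i1 + length js"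
    using Cons st by simp
  ultimately show ?case by auto
qed simp

lemma partition_in_place_bounds:
  assumes "partition_in_place S = (T, i, c)" and "S \<noteq> []"
  shows "length T = length S" and "i < length S"
proof -
  obtain T0 i0 c0 where
    f: "fold (part_step (S ! (length S - 1))) [0..<length S - 1] (S, 0, 0) = (T0, i0, c0)"
    by (metis prod_cases3)
  from fold_part_step_bounds[OF f] assms f show "length T = length S" and "i < length S"
    by (auto simp: partition_in_place_def Let_def swap_at_def neq_Nil_conv split: if_splits)
qed

text \<open>
  The two recursive calls work on disjoint segments of the array, so they are modelled on the
  sublists themselves. Result: the sorted list and the total number of swaps.
\<close>

function quicksort :: "'a::linorder list \<Rightarrow> 'a list \<times> nat" where
  "quicksort S =
     (if length S \<le> 1 then (S, 0)
      else let (T, i, c) = partition_in_place S;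
               (L, cl) = quicksort (take i T);
               (R, cr) = quicksort (drop (Suc i) T)
           in (L @ T ! i # R, c + cl + cr))"
  by pat_completeness auto
termination
proof (relation "Wellfounded.measure length", goal_cases)
  case 1
  show ?case by simp
next
  case (2 S x T y i c)
  then show ?case using partition_in_place_bounds[of S T i c] by fastforce
next
  case (3 S x T y i c)
  then show ?case using partition_in_place_bounds[of S T i c] by fastforce
qed

declare quicksort.simps [simp del]

definition swap_count :: "'a::linorder list \<Rightarrow> nat" where
  "swap_count S = snd (quicksort S)"

end

theory Submission imports Defs begin

text \<open>
  The proof is the usual one for Quicksort: condition on the rank of the pivot, and use that the
  two sublists left over by the partitioning are again uniformly distributed. The work lies in
  justifying that last claim for the concrete array program and in counting its swaps.

  Write the input as \<open>xs @ [p]\<close> with pivot \<open>p\<close>. While the loop runs, the part of the array read so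
  far consists of the elements below \<open>p\<close> in their original order, followed by the elements above
  \<open>p\<close>. A new large element is appended to the block of large ones; a new small element is exchanged
  with the first of them, which rotates the block by one. So the large block is a queue
  (\<open>large_queue\<close>), and the partitioned array has the closed form of \<open>partition_in_place_snoc\<close>.

  Both sublists commute with every permutation of the elements that they contain, since the program
  compares elements with \<open>p\<close> only. The distribution of a sublist is therefore invariant under the
  full symmetric group of its elements, which acts transitively on their orderings, so it is uniform
  (\<open>uniform_perm_equivariant\<close>), however the rotations shuffle the large elements.

  If \<open>p\<close> has \<open>k\<close> smaller and \<open>m\<close> larger elements, a small element is swapped unless it precedes all
  large ones. It does so with probability \<open>1 / (m + 1)\<close>: the first among it and the large elements
  is equally likely to be any of them. One more swap places the pivot if \<open>m > 0\<close>. The expected cost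
  \<open>k - k / (m + 1) + [m > 0]\<close>, summed over the ranks, equals
  \<open>n (n - 1) / 2 - n H(n) + 2 n - 1\<close>, and the resulting recurrence
  \<open>n e(n) = n (n - 1) / 2 - n H(n) + 2 n - 1 + 2 (e(0) + \<dots> + e(n - 1))\<close>
  has the stated solution. The closed form fails at \<open>n = 0\<close>, where the mean is 0.
\<close>

section \<open>The effect of partitioning on the array\<close>

text \<open>
  The block of elements above the pivot, as left by the loop. Exchanging a small element with the
  head of the block moves that head behind the block, hence the rotation. Rotating an empty block
  does nothing, which matches the skipped self-swap.
\<close>
definition large_queue :: "'a::linorder \<Rightarrow> 'a list \<Rightarrow> 'a list" where
  "large_queue p xs = foldl (\<lambda>Q x. if x \<le> p then rotate1 Q else Q @ [x]) [] xs"

lemma mset_rotate1 [simp]: "mset (rotate1 xs) = mset xs"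
  by (cases xs) auto

lemma mset_large_queue: "mset (large_queue p xs) = mset (filter (\<lambda>x. p < x) xs)"
  by (induction xs rule: rev_induct) (auto simp: large_queue_def)

text \<open>The queue sees its entries only through their comparisons with the pivot.\<close>
lemma large_queue_map:
  assumes "\<And>x. x \<in> set xs \<Longrightarrow> \<sigma> x \<le> p \<longleftrightarrow> x \<le> p"
  shows "large_queue p (map \<sigma> xs) = map \<sigma> (large_queue p xs)"
  using assms by (induction xs rule: rev_induct) (auto simp: large_queue_def rotate1_map)

lemma length_large_queue:
  "length (filter (\<lambda>x. x \<le> p) xs) + length (large_queue p xs) = length xs"
proof -
  have "length (large_queue p xs) = length (filter (\<lambda>x. p < x) xs)"
    by (rule mset_eq_length[OF mset_large_queue])
  also have "\<dots> = length (filter (\<lambda>x. \<not> x \<le> p) xs)"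
    by (simp add: not_le)
  finally have "length (large_queue p xs) = \<dots>" .
  then show ?thesis
    by (simp add: sum_length_filter_compl)
qed

lemma large_queue_eq_Nil: "large_queue p xs = [] \<longleftrightarrow> (\<forall>x\<in>set xs. x \<le> p)"
proof -
  have "large_queue p xs = [] \<longleftrightarrow> filter (\<lambda>x. p < x) xs = []"
    using mset_large_queue[of p xs] by (metis mset_zero_iff)
  then show ?thesis
    by (auto simp: filter_empty_conv not_less)
qed

text \<open>
  The loop invariant, with \<open>ys\<close> for the unread part. A small element is swapped exactly if the
  queue is nonempty when it is read, that is, if it comes after some large element; the counter
  thus counts the small elements outside the longest all-small prefix.
\<close>
lemma fold_part_step:
  "fold (part_step p) [0..<length xs] (xs @ ys, 0, 0) =
     (filter (\<lambda>x. x \<le> p) xs @ large_queue p xs @ ys, length (filter (\<lambda>x. x \<le> p) xs),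
      length (filter (\<lambda>x. x \<le> p) (dropWhile (\<lambda>x. x \<le> p) xs)))"
proof (induction xs arbitrary: ys rule: rev_induct)
  case Nil
  show ?case by (simp add: large_queue_def)
next
  case (snoc x xs)
  define fs where "fs = filter (\<lambda>x. x \<le> p) xs"
  define Q where "Q = large_queue p xs"
  define c where "c = length (filter (\<lambda>x. x \<le> p) (dropWhile (\<lambda>x. x \<le> p) xs))"
  have len: "length xs = length fs + length Q"
    using length_large_queue[of p xs] by (simp add: fs_def Q_def)
  have Q_snoc: "large_queue p (xs @ [x]) = (if x \<le> p then rotate1 Q else Q @ [x])"
    by (simp add: large_queue_def Q_def)
  \<comment> \<open>The element inspected in this round is the first unread one.\<close>
  have nth: "(fs @ Q @ x # ys) ! (length fs + length Q) = x"
    by (metis append.assoc length_append nth_append_length)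
  have "fold (part_step p) [0..<length (xs @ [x])] ((xs @ [x]) @ ys, 0, 0) =
        part_step p (length xs) (fs @ Q @ x # ys, length fs, c)"
    using snoc[of "x # ys"] by (simp add: fs_def Q_def c_def)
  also have "\<dots> = (filter (\<lambda>x. x \<le> p) (xs @ [x]) @ large_queue p (xs @ [x]) @ ys,
      length (filter (\<lambda>x. x \<le> p) (xs @ [x])),
      length (filter (\<lambda>x. x \<le> p) (dropWhile (\<lambda>x. x \<le> p) (xs @ [x]))))"
  proof (cases "x \<le> p")
    case False
    have "filter (\<lambda>x. x \<le> p) (dropWhile (\<lambda>x. x \<le> p) (xs @ [x])) =
          filter (\<lambda>x. x \<le> p) (dropWhile (\<lambda>x. x \<le> p) xs)"
    proof (cases "\<forall>y\<in>set xs. y \<le> p")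
      case True
      then have "dropWhile (\<lambda>x. x \<le> p) xs = []" by simp
      with True \<open>\<not> x \<le> p\<close> show ?thesis
        by (simp del: dropWhile_eq_Nil_conv)
    next
      case False
      then show ?thesis using \<open>\<not> x \<le> p\<close> by (auto simp: dropWhile_append)
    qed
    with False show ?thesis
      using nth by (simp add: part_step_def len Q_snoc fs_def[symmetric] c_def)
  next
    case True
    show ?thesis
    proof (cases Q)
      case Nil
      then have all: "\<forall>x\<in>set xs. x \<le> p"
        using large_queue_eq_Nil[of p xs] by (simp add: Q_def)
      then have "dropWhile (\<lambda>x. x \<le> p) xs = []" by simp
      with all Nil True show ?thesis
        using nth by (simp add: part_step_def len Q_snoc fs_def[symmetric] c_def
            del: dropWhile_eq_Nil_conv)
    next
      case (Cons q Q')
      then have "\<not> (\<forall>x\<in>set xs. x \<le> p)"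
        using large_queue_eq_Nil[of p xs] by (simp add: Q_def)
      then have "dropWhile (\<lambda>x. x \<le> p) (xs @ [x]) = dropWhile (\<lambda>x. x \<le> p) xs @ [x]"
        by (auto simp: dropWhile_append)
      with Cons True show ?thesis
        using nth
        by (simp add: part_step_def len Q_snoc fs_def[symmetric] c_def swap_at_def
            list_update_append nth_append)
    qed
  qed
  finally show ?case .
qed

definition partition_swaps :: "'a::linorder \<Rightarrow> 'a list \<Rightarrow> nat" where
  "partition_swaps p xs = length (filter (\<lambda>x. x \<le> p) (dropWhile (\<lambda>x. x \<le> p) xs))
     + of_bool (\<exists>x\<in>set xs. p < x)"

text \<open>
  The final exchange sends the head of the queue to the far end, so it is one more rotation.
\<close>
lemma partition_in_place_snoc:
  "partition_in_place (xs @ [p]) =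
     (filter (\<lambda>x. x \<le> p) xs @ p # rotate1 (large_queue p xs),
      length (filter (\<lambda>x. x \<le> p) xs), partition_swaps p xs)"
proof -
  define fs where "fs = filter (\<lambda>x. x \<le> p) xs"
  define Q where "Q = large_queue p xs"
  have len: "length xs = length fs + length Q"
    using length_large_queue[of p xs] by (simp add: fs_def Q_def)
  define c where "c = length (filter (\<lambda>x. x \<le> p) (dropWhile (\<lambda>x. x \<le> p) xs))"
  have "partition_in_place (xs @ [p]) =
      (if length fs \<noteq> length xs
       then (swap_at (fs @ Q @ [p]) (length fs) (length xs), length fs, Suc c)
       else (fs @ Q @ [p], length fs, c))"
    by (simp add: partition_in_place_def fold_part_step fs_def Q_def c_def)
  moreover have "partition_swaps p xs = c + of_bool (Q \<noteq> [])"
    by (auto simp: partition_swaps_def c_def Q_def large_queue_eq_Nil not_le)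
  ultimately show ?thesis
    unfolding fs_def[symmetric] Q_def[symmetric]
    by (cases Q) (simp_all add: len swap_at_def list_update_append nth_append)
qed

lemma swap_count_Nil [simp]: "swap_count [] = 0"
  by (simp add: swap_count_def quicksort.simps)

text \<open>
  This holds for the one-element list as well, since partitioning it would cost nothing.
\<close>
lemma swap_count_snoc:
  "swap_count (xs @ [p]) = partition_swaps p xs
     + swap_count (filter (\<lambda>x. x \<le> p) xs) + swap_count (rotate1 (large_queue p xs))"
proof (cases "xs = []")
  case True
  then show ?thesis
    by (simp add: swap_count_def quicksort.simps partition_swaps_def large_queue_def)
next
  case False
  then have "\<not> length (xs @ [p]) \<le> 1" by (cases xs) auto
  then show ?thesis
    unfolding swap_count_def
    by (subst quicksort.simps) (simp add: partition_in_place_snoc split: prod.splits)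
qed

section \<open>Uniformity of the sublists\<close>

abbreviation uniform_perm :: "'a set \<Rightarrow> 'a list pmf" where
  "uniform_perm A \<equiv> pmf_of_set (permutations_of_set A)"

lemma set_pmf_uniform_perm: "finite A \<Longrightarrow> set_pmf (uniform_perm A) = permutations_of_set A"
  by (rule set_pmf_of_set) auto

lemma map_pmf_uniform_perm_permutes:
  assumes "finite A" "\<sigma> permutes A"
  shows "map_pmf (map \<sigma>) (uniform_perm A) = uniform_perm A"
proof -
  have "inj_on (map \<sigma>) (permutations_of_set A)"
    using permutes_inj[OF assms(2)] by (meson inj_on_subset inj_mapI subset_UNIV)
  then have "map_pmf (map \<sigma>) (uniform_perm A) = pmf_of_set (map \<sigma> ` permutations_of_set A)"
    using assms(1) by (intro map_pmf_of_set_inj) auto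
  also have "map \<sigma> ` permutations_of_set A = permutations_of_set (\<sigma> ` A)"
    by (rule permutations_of_set_image_inj[symmetric])
       (rule inj_on_subset[OF permutes_inj[OF assms(2)] subset_UNIV])
  finally show ?thesis
    using permutes_image[OF assms(2)] by simp
qed

text \<open>The symmetric group acts transitively on the orderings of a finite set.\<close>
lemma obtain_permutes_between_lists:
  assumes "ys \<in> permutations_of_set B" "zs \<in> permutations_of_set B"
  obtains \<sigma> where "\<sigma> permutes B" "map \<sigma> ys = zs"
proof
  have ys: "set ys = B" "distinct ys" and zs: "set zs = B" "distinct zs"
    using assms by (auto simp: permutations_of_set_def)
  then have len: "length ys = length zs"
    by (metis distinct_card)
  show "permutation_of_list (zip ys zs) permutes B"
    using ys zs len by (intro permutation_of_list_permutes list_permutesI) auto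
  show "map (permutation_of_list (zip ys zs)) ys = zs"
    using ys len by (intro nth_equalityI) (auto simp: permutation_of_list_def map_of_zip_nth)
qed

text \<open>
  The image distribution is invariant under all permutations of \<open>B\<close>, because the uniform
  distribution on the orderings of \<open>A\<close> is. As these act transitively on the orderings of \<open>B\<close>, all
  orderings of \<open>B\<close> get the same probability.
\<close>
lemma uniform_perm_equivariant:
  assumes "finite A" "B \<subseteq> A"
    and into: "\<And>xs. xs \<in> permutations_of_set A \<Longrightarrow> F xs \<in> permutations_of_set B"
    and equiv: "\<And>\<sigma> xs. \<sigma> permutes B \<Longrightarrow> xs \<in> permutations_of_set A \<Longrightarrow> F (map \<sigma> xs) = map \<sigma> (F xs)"
  shows "map_pmf F (uniform_perm A) = uniform_perm B"
proof -
  define q where "q = map_pmf F (uniform_perm A)"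
  have fin: "finite B" using assms(1,2) by (rule finite_subset[rotated])
  have invariant: "map_pmf (map \<sigma>) q = q" if "\<sigma> permutes B" for \<sigma>
  proof -
    have "map_pmf (map \<sigma>) q = map_pmf F (map_pmf (map \<sigma>) (uniform_perm A))"
      unfolding q_def map_pmf_comp
      by (intro map_pmf_cong) (auto simp: set_pmf_uniform_perm assms(1) equiv that)
    also have "\<dots> = q"
      using map_pmf_uniform_perm_permutes[OF assms(1) permutes_subset[OF that assms(2)]]
      by (simp add: q_def)
    finally show ?thesis .
  qed
  have support: "set_pmf q \<subseteq> permutations_of_set B"
    by (auto simp: q_def set_pmf_uniform_perm assms(1) into)
  have const: "pmf q zs = pmf q ys"
    if ys: "ys \<in> permutations_of_set B" and zs: "zs \<in> permutations_of_set B" for ys zs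
  proof -
    obtain \<sigma> where \<sigma>: "\<sigma> permutes B" "map \<sigma> ys = zs"
      using obtain_permutes_between_lists[OF ys zs] .
    have "inj (map \<sigma>)" using permutes_inj[OF \<sigma>(1)] by simp
    then have "pmf (map_pmf (map \<sigma>) q) (map \<sigma> ys) = pmf q ys"
      by (rule pmf_map_inj')
    then show ?thesis using invariant[OF \<sigma>(1)] \<sigma>(2) by simp
  qed
  have "pmf q ys = pmf (uniform_perm B) ys" for ys
  proof (cases "ys \<in> permutations_of_set B")
    case True
    have "1 = (\<Sum>zs\<in>permutations_of_set B. pmf q zs)"
      using support by (intro sum_pmf_eq_1[symmetric]) auto
    also have "\<dots> = card (permutations_of_set B) * pmf q ys"
      using const[OF True] by simp
    finally show ?thesis
      using True fin by (auto simp: divide_simps mult.commute)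
  next
    case False
    then show ?thesis
      using support fin by (auto simp: pmf_eq_0_set_pmf)
  qed
  then show ?thesis unfolding q_def by (rule pmf_eqI)
qed

lemma uniform_perm_filter:
  assumes "finite A" "B \<subseteq> A"
  shows "map_pmf (filter (\<lambda>x. x \<in> B)) (uniform_perm A) = uniform_perm B"
proof (rule uniform_perm_equivariant[OF assms])
  fix xs assume "xs \<in> permutations_of_set A"
  then show "filter (\<lambda>x. x \<in> B) xs \<in> permutations_of_set B"
    using assms(2) by (auto simp: permutations_of_set_def)
next
  fix \<sigma> :: "'a \<Rightarrow> 'a" and xs :: "'a list"
  assume "\<sigma> permutes B"
  then show "filter (\<lambda>x. x \<in> B) (map \<sigma> xs) = map \<sigma> (filter (\<lambda>x. x \<in> B) xs)"
    by (simp add: filter_map comp_def permutes_in_image)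
qed

text \<open>
  A permutation of the large elements keeps large elements large and fixes the others, so no
  comparison with the pivot changes.
\<close>
lemma uniform_perm_large_queue:
  assumes "finite A" "p \<notin> A"
  shows "map_pmf (\<lambda>xs. rotate1 (large_queue p xs)) (uniform_perm A) = uniform_perm {x \<in> A. p < x}"
proof (rule uniform_perm_equivariant[OF assms(1)])
  fix xs assume "xs \<in> permutations_of_set A"
  then have xs: "set xs = A" "distinct xs" by (auto simp: permutations_of_set_def)
  have "mset (rotate1 (large_queue p xs)) = mset (filter (\<lambda>x. p < x) xs)"
    by (simp add: mset_large_queue)
  then have "set (rotate1 (large_queue p xs)) = set (filter (\<lambda>x. p < x) xs)"
    "distinct (rotate1 (large_queue p xs)) = distinct (filter (\<lambda>x. p < x) xs)"
    by (metis mset_eq_setD, metis mset_eq_imp_distinct_iff)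
  then show "rotate1 (large_queue p xs) \<in> permutations_of_set {x \<in> A. p < x}"
    using xs by (auto simp: permutations_of_set_def)
next
  fix \<sigma> :: "'a \<Rightarrow> 'a" and xs :: "'a list"
  assume \<sigma>: "\<sigma> permutes {x \<in> A. p < x}"
  have "\<sigma> x \<le> p \<longleftrightarrow> x \<le> p" for x
    using permutes_in_image[OF \<sigma>, of x] permutes_not_in[OF \<sigma>, of x]
    by (cases "x \<in> {x \<in> A. p < x}") auto
  then show "rotate1 (large_queue p (map \<sigma> xs)) = map \<sigma> (rotate1 (large_queue p xs))"
    by (simp add: large_queue_map rotate1_map)
qed auto

section \<open>Averages over the orderings of a set\<close>

abbreviation perm_mean :: "'a set \<Rightarrow> ('a list \<Rightarrow> real) \<Rightarrow> real" where
  "perm_mean A f \<equiv> measure_pmf.expectation (uniform_perm A) f"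

lemma integrable_uniform_perm [simp]:
  "finite A \<Longrightarrow> integrable (measure_pmf (uniform_perm A)) (f :: _ \<Rightarrow> real)"
  by (rule integrable_measure_pmf_finite) (simp add: set_pmf_uniform_perm)

lemma perm_mean_eq_sum:
  "finite A \<Longrightarrow> perm_mean A f = (\<Sum>xs\<in>permutations_of_set A. f xs) / fact (card A)"
  by (subst integral_pmf_of_set) auto

lemma perm_mean_cong:
  assumes "finite A" "\<And>xs. xs \<in> permutations_of_set A \<Longrightarrow> f xs = g xs"
  shows "perm_mean A f = perm_mean A g"
  using assms by (simp add: perm_mean_eq_sum)

lemma sum_permutations_of_set_Cons:
  assumes "finite A" "A \<noteq> {}"
  shows "(\<Sum>xs\<in>permutations_of_set A. f xs) =
         (\<Sum>p\<in>A. \<Sum>xs\<in>permutations_of_set (A - {p}). f (p # xs))"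
proof -
  have "(\<Sum>xs\<in>permutations_of_set A. f xs) =
        (\<Sum>xs\<in>(\<Union>p\<in>A. (#) p ` permutations_of_set (A - {p})). f xs)"
    by (simp only: permutations_of_set_nonempty[OF assms(2)])
  also have "\<dots> = (\<Sum>p\<in>A. \<Sum>xs\<in>(#) p ` permutations_of_set (A - {p}). f xs)"
    using assms(1) by (intro sum.UNION_disjoint) auto
  also have "\<dots> = (\<Sum>p\<in>A. \<Sum>xs\<in>permutations_of_set (A - {p}). f (p # xs))"
    by (simp add: sum.reindex)
  finally show ?thesis .
qed

lemma sum_permutations_of_set_rev:
  "(\<Sum>xs\<in>permutations_of_set A. f (rev xs)) = (\<Sum>xs\<in>permutations_of_set A. f xs)"
  by (rule sum.reindex_bij_witness[of _ rev rev]) (auto simp: permutations_of_set_def)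

lemma sum_permutations_of_set_snoc:
  assumes "finite A" "A \<noteq> {}"
  shows "(\<Sum>xs\<in>permutations_of_set A. f xs) =
         (\<Sum>p\<in>A. \<Sum>xs\<in>permutations_of_set (A - {p}). f (xs @ [p]))"
proof -
  have "(\<Sum>xs\<in>permutations_of_set A. f xs) = (\<Sum>xs\<in>permutations_of_set A. f (rev xs))"
    by (simp add: sum_permutations_of_set_rev)
  also have "\<dots> = (\<Sum>p\<in>A. \<Sum>xs\<in>permutations_of_set (A - {p}). f (rev xs @ [p]))"
    using assms by (simp add: sum_permutations_of_set_Cons)
  also have "\<dots> = (\<Sum>p\<in>A. \<Sum>xs\<in>permutations_of_set (A - {p}). f (xs @ [p]))"
    by (intro sum.cong refl sum_permutations_of_set_rev[of "\<lambda>xs. f (xs @ [_])"])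
  finally show ?thesis .
qed

text \<open>Conditioning on the last entry, which is uniform on the set; it serves as the pivot.\<close>
lemma perm_mean_snoc:
  assumes "finite A" "A \<noteq> {}"
  shows "real (card A) * perm_mean A f = (\<Sum>p\<in>A. perm_mean (A - {p}) (\<lambda>xs. f (xs @ [p])))"
proof -
  have "card A > 0"
    using assms by (simp add: card_gt_0_iff)
  then have "fact (card A) = real (card A) * fact (card A - 1)"
    by (rule fact_reduce)
  then have "real (card A) * perm_mean A f = (\<Sum>xs\<in>permutations_of_set A. f xs) / fact (card A - 1)"
    using assms by (simp add: perm_mean_eq_sum)
  then show ?thesis
    using assms by (simp add: perm_mean_eq_sum sum_permutations_of_set_snoc sum_divide_distrib)
qed

lemma perm_mean_hd_eq:
  assumes "finite A" "x \<in> A"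
  shows "perm_mean A (\<lambda>xs. of_bool (hd xs = x)) = 1 / card A"
proof -
  have nonempty: "A \<noteq> {}" and pos: "card A > 0"
    using assms by (auto simp: card_gt_0_iff)
  have "(\<Sum>xs\<in>permutations_of_set A. of_bool (hd xs = x) :: real) =
        (\<Sum>p\<in>A. of_bool (p = x) * fact (card A - 1))"
    unfolding sum_permutations_of_set_Cons[OF assms(1) nonempty]
    by (rule sum.cong) (use assms in auto)
  also have "\<dots> = fact (card A - 1)"
    using assms by (subst sum.remove[of A x]) (auto intro!: sum.neutral)
  finally show ?thesis
    using assms pos by (simp add: perm_mean_eq_sum fact_reduce)
qed

section \<open>Expected cost of one partitioning\<close>

text \<open>
  An entry satisfying \<open>P\<close> lies in the maximal \<open>P\<close>-prefix iff it comes first among itself and the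
  entries violating \<open>P\<close>. In this form, the probability of the event can be read off a uniformly
  random ordering of a smaller set.
\<close>
lemma mem_takeWhile_iff_hd_filter:
  assumes "x \<in> set xs" "P x"
  shows "x \<in> set (takeWhile P xs) \<longleftrightarrow> hd (filter (\<lambda>y. y = x \<or> \<not> P y) xs) = x"
  using assms by (induction xs) auto

text \<open>
  Linearity of expectation: each element satisfying \<open>P\<close> precedes all those violating \<open>P\<close> with
  probability one over their number plus one.
\<close>
lemma perm_mean_length_takeWhile:
  assumes "finite A"
  shows "perm_mean A (\<lambda>xs. real (length (takeWhile P xs))) =
         real (card {x \<in> A. P x}) / (real (card {x \<in> A. \<not> P x}) + 1)"
proof -
  have "perm_mean A (\<lambda>xs. real (length (takeWhile P xs))) =
        perm_mean A (\<lambda>xs. \<Sum>x | x \<in> A \<and> P x. of_bool (hd (filter (\<lambda>y. y \<in> insert x {y\<in>A. \<not> P y}) xs) = x))"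
  proof (rule perm_mean_cong[OF assms])
    fix xs assume "xs \<in> permutations_of_set A"
    then have xs: "set xs = A" "distinct xs" by (auto simp: permutations_of_set_def)
    have "real (length (takeWhile P xs)) = real (card (set (takeWhile P xs)))"
      using xs by (simp add: distinct_card)
    also have "set (takeWhile P xs) = {x \<in> {x \<in> A. P x}. x \<in> set (takeWhile P xs)}"
      using xs by (auto dest: set_takeWhileD)
    also have "real (card \<dots>) = (\<Sum>x | x \<in> A \<and> P x. of_bool (x \<in> set (takeWhile P xs)))"
      using assms by (simp add: Int_def)
    also have "\<dots> = (\<Sum>x | x \<in> A \<and> P x.
        of_bool (hd (filter (\<lambda>y. y \<in> insert x {y\<in>A. \<not> P y}) xs) = x))"
    proof (rule sum.cong[OF refl])
      fix x assume x: "x \<in> {x \<in> A. P x}"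
      have "filter (\<lambda>y. y \<in> insert x {y\<in>A. \<not> P y}) xs = filter (\<lambda>y. y = x \<or> \<not> P y) xs"
        using xs by (intro filter_cong) auto
      then show "of_bool (x \<in> set (takeWhile P xs)) =
          (of_bool (hd (filter (\<lambda>y. y \<in> insert x {y\<in>A. \<not> P y}) xs) = x) :: real)"
        using x xs by (simp add: mem_takeWhile_iff_hd_filter)
    qed
    finally show "real (length (takeWhile P xs)) = \<dots>" .
  qed
  also have "\<dots> = (\<Sum>x | x \<in> A \<and> P x.
      perm_mean A (\<lambda>xs. of_bool (hd (filter (\<lambda>y. y \<in> insert x {y\<in>A. \<not> P y}) xs) = x)))"
    using assms by (intro Bochner_Integration.integral_sum) simp
  also have "\<dots> = (\<Sum>x | x \<in> A \<and> P x. 1 / (real (card {x \<in> A. \<not> P x}) + 1))"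
  proof (rule sum.cong[OF refl])
    fix x assume x: "x \<in> {x \<in> A. P x}"
    let ?B = "insert x {y \<in> A. \<not> P y}"
    have "perm_mean A (\<lambda>xs. of_bool (hd (filter (\<lambda>y. y \<in> ?B) xs) = x)) =
          measure_pmf.expectation (map_pmf (filter (\<lambda>y. y \<in> ?B)) (uniform_perm A))
            (\<lambda>xs. of_bool (hd xs = x))"
      by simp
    also have "map_pmf (filter (\<lambda>y. y \<in> ?B)) (uniform_perm A) = uniform_perm ?B"
      using assms x by (intro uniform_perm_filter) auto
    also have "perm_mean ?B (\<lambda>xs. of_bool (hd xs = x)) = 1 / card ?B"
      using assms by (intro perm_mean_hd_eq) auto
    also have "real (card ?B) = real (card {x \<in> A. \<not> P x}) + 1"
      using assms x by simp
    finally show "perm_mean A (\<lambda>xs. of_bool (hd (filter (\<lambda>y. y \<in> ?B) xs) = x)) =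
      1 / (real (card {x \<in> A. \<not> P x}) + 1)" .
  qed
  finally show ?thesis by simp
qed

text \<open>
  The small elements that are not swapped form the maximal prefix of small elements. If there is no
  large element, the first two terms cancel.
\<close>
lemma perm_mean_partition_swaps:
  assumes "finite A" "p \<notin> A"
  defines "k \<equiv> card {x \<in> A. x < p}" and "m \<equiv> card {x \<in> A. p < x}"
  shows "perm_mean A (\<lambda>xs. real (partition_swaps p xs)) =
         real k - real k / (real m + 1) + of_bool (m > 0)"
proof -
  have small: "{x \<in> A. x \<le> p} = {x \<in> A. x < p}" and large: "{x \<in> A. \<not> x \<le> p} = {x \<in> A. p < x}"
    using assms(2) by (auto simp: less_le)
  have "perm_mean A (\<lambda>xs. real (partition_swaps p xs)) =
        perm_mean A (\<lambda>xs. real k + of_bool (m > 0) - real (length (takeWhile (\<lambda>x. x \<le> p) xs)))"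
  proof (rule perm_mean_cong[OF assms(1)])
    fix xs assume "xs \<in> permutations_of_set A"
    then have xs: "set xs = A" "distinct xs" by (auto simp: permutations_of_set_def)
    let ?P = "\<lambda>x. x \<le> p"
    have "length (filter ?P xs) =
          length (filter ?P (takeWhile ?P xs)) + length (filter ?P (dropWhile ?P xs))"
      by (metis filter_append length_append takeWhile_dropWhile_id)
    moreover have "filter ?P (takeWhile ?P xs) = takeWhile ?P xs"
      by (auto simp: filter_id_conv dest: set_takeWhileD)
    moreover have "length (filter ?P xs) = k"
      using distinct_card[of "filter ?P xs"] xs by (simp add: k_def small)
    moreover have "(\<exists>x\<in>set xs. p < x) \<longleftrightarrow> m > 0"
      using assms(1) xs by (auto simp: m_def card_gt_0_iff)
    ultimately show "real (partition_swaps p xs) =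
        real k + of_bool (m > 0) - real (length (takeWhile ?P xs))"
      by (simp add: partition_swaps_def)
  qed
  also have "\<dots> = real k + of_bool (m > 0) - perm_mean A (\<lambda>xs. real (length (takeWhile (\<lambda>x. x \<le> p) xs)))"
    using assms(1) by (subst Bochner_Integration.integral_diff) auto
  finally show ?thesis
    using assms(1) by (simp add: perm_mean_length_takeWhile small large k_def m_def)
qed

section \<open>The recurrence and its solution\<close>

text \<open>
  The cost of partitioning and the arrangement of the large elements both depend on where the small
  elements stand, but by linearity of expectation only the individual distributions matter.
\<close>
lemma perm_mean_swap_count_snoc:
  assumes "finite A" "p \<notin> A"
  shows "perm_mean A (\<lambda>xs. real (swap_count (xs @ [p]))) =
         perm_mean A (\<lambda>xs. real (partition_swaps p xs))
         + perm_mean {x \<in> A. x < p} (\<lambda>xs. real (swap_count xs))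
         + perm_mean {x \<in> A. p < x} (\<lambda>xs. real (swap_count xs))"
proof -
  have "perm_mean A (\<lambda>xs. real (swap_count (xs @ [p]))) =
        perm_mean A (\<lambda>xs. real (partition_swaps p xs)
          + real (swap_count (filter (\<lambda>x. x \<in> {x \<in> A. x < p}) xs))
          + real (swap_count (rotate1 (large_queue p xs))))"
  proof (rule perm_mean_cong[OF assms(1)])
    fix xs assume "xs \<in> permutations_of_set A"
    then have "filter (\<lambda>x. x \<le> p) xs = filter (\<lambda>x. x \<in> {x \<in> A. x < p}) xs"
      using assms(2) by (intro filter_cong) (auto simp: permutations_of_set_def less_le)
    then show "real (swap_count (xs @ [p])) = real (partition_swaps p xs)
          + real (swap_count (filter (\<lambda>x. x \<in> {x \<in> A. x < p}) xs))
          + real (swap_count (rotate1 (large_queue p xs)))"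
      by (simp add: swap_count_snoc)
  qed
  also have "\<dots> = perm_mean A (\<lambda>xs. real (partition_swaps p xs))
      + perm_mean A (\<lambda>xs. real (swap_count (filter (\<lambda>x. x \<in> {x \<in> A. x < p}) xs)))
      + perm_mean A (\<lambda>xs. real (swap_count (rotate1 (large_queue p xs))))"
    using assms(1) by simp
  also have "perm_mean A (\<lambda>xs. real (swap_count (filter (\<lambda>x. x \<in> {x \<in> A. x < p}) xs))) =
      measure_pmf.expectation (map_pmf (filter (\<lambda>x. x \<in> {x \<in> A. x < p})) (uniform_perm A))
        (\<lambda>xs. real (swap_count xs))"
    by simp
  also have "map_pmf (filter (\<lambda>x. x \<in> {x \<in> A. x < p})) (uniform_perm A) = uniform_perm {x \<in> A. x < p}"
    using assms(1) by (intro uniform_perm_filter) auto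
  also have "perm_mean A (\<lambda>xs. real (swap_count (rotate1 (large_queue p xs)))) =
      measure_pmf.expectation (map_pmf (\<lambda>xs. rotate1 (large_queue p xs)) (uniform_perm A))
        (\<lambda>xs. real (swap_count xs))"
    by simp
  also have "map_pmf (\<lambda>xs. rotate1 (large_queue p xs)) (uniform_perm A) = uniform_perm {x \<in> A. p < x}"
    using assms by (rule uniform_perm_large_queue)
  finally show ?thesis .
qed

text \<open>Turns a sum over pivots into a sum over their ranks.\<close>
lemma bij_betw_rank:
  fixes A :: "'a::linorder set"
  assumes "finite A"
  shows "bij_betw (\<lambda>p. card {x \<in> A. x < p}) A {..<card A}"
proof -
  have less: "card {x \<in> A. x < p} < card {x \<in> A. x < q}" if "p \<in> A" "p < q" for p q
    using assms that by (intro psubset_card_mono) auto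
  have inj: "inj_on (\<lambda>p. card {x \<in> A. x < p}) A"
    by (rule linorder_inj_onI') (use less in fastforce)
  have "card {x \<in> A. x < p} < card A" if "p \<in> A" for p
    using assms that by (intro psubset_card_mono) auto
  then have "(\<lambda>p. card {x \<in> A. x < p}) ` A \<subseteq> {..<card A}" by auto
  then have "(\<lambda>p. card {x \<in> A. x < p}) ` A = {..<card A}"
    by (rule card_subset_eq[rotated]) (auto simp: card_image inj)
  with inj show ?thesis by (simp add: bij_betw_def)
qed

lemma card_greater_eq_rank:
  fixes A :: "'a::linorder set"
  assumes "finite A" "p \<in> A"
  shows "card {x \<in> A. p < x} = card A - 1 - card {x \<in> A. x < p}"
proof -
  have split: "A - {p} = {x \<in> A. x < p} \<union> {x \<in> A. p < x}" by auto
  have "card (A - {p}) = card {x \<in> A. x < p} + card {x \<in> A. p < x}"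
    unfolding split using assms(1) by (intro card_Un_disjoint) auto
  with assms show ?thesis by simp
qed

lemma sum_partition_swaps:
  assumes "n \<ge> 1"
  shows "(\<Sum>k<n. real k - real k / (real (n - 1 - k) + 1) + of_bool (n - 1 - k > 0)) =
         real n * (real n - 1) / 2 - real n * harm n + 2 * real n - 1"
proof -
  have "(\<Sum>k<n. real k) = real n * (real n - 1) / 2"
    by (induction n) (auto simp: field_simps)
  moreover have "(\<Sum>k<n. real k / (real (n - 1 - k) + 1)) = real n * harm n - real n"
  proof -
    \<comment> \<open>The denominator is \<open>n - k\<close>, and \<open>k / (n - k) = n / (n - k) - 1\<close>.\<close>
    have "(\<Sum>k<n. real k / (real (n - 1 - k) + 1)) =
          (\<Sum>k<n. real n * inverse (real (Suc (n - Suc k))) - 1)"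
      by (intro sum.cong refl) (auto simp: field_simps)
    also have "\<dots> = real n * (\<Sum>k<n. inverse (real (Suc (n - Suc k)))) - real n"
      by (simp add: sum_subtractf sum_distrib_left)
    also have "(\<Sum>k<n. inverse (real (Suc (n - Suc k)))) = (\<Sum>k<n. inverse (real (Suc k)))"
      by (rule sum.nat_diff_reindex[of "\<lambda>k. inverse (real (Suc k))"])
    also have "\<dots> = harm n"
      by (simp add: harm_def sum.atLeast1_atMost_eq)
    finally show ?thesis .
  qed
  moreover have "(\<Sum>k<n. of_bool (n - 1 - k > 0) :: real) = real n - 1"
    using assms by (cases n) auto
  ultimately show ?thesis
    by (simp add: sum.distrib sum_subtractf)
qed

definition mean_swaps :: "nat \<Rightarrow> real" where
  "mean_swaps n = (if n = 0 then 0 else (real n + 2) * harm n - 5 / 2 * real n - 1 / 2)"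

text \<open>
  The recurrence determines the sum of all earlier values, so passing from \<open>n\<close> to \<open>n + 1\<close> gives a
  relation between two consecutive values, which the closed form satisfies.
\<close>
lemma mean_swaps_recurrence:
  assumes "n \<ge> 1"
  shows "real n * mean_swaps n =
    real n * (real n - 1) / 2 - real n * harm n + 2 * real n - 1 + 2 * (\<Sum>k<n. mean_swaps k)"
  using assms
proof (induction n rule: dec_induct)
  case base
  show ?case by (simp add: mean_swaps_def harm_expand)
next
  case (step n)
  have sum_eq: "2 * (\<Sum>k<Suc n. mean_swaps k) = real n * mean_swaps n
      - (real n * (real n - 1) / 2 - real n * harm n + 2 * real n - 1) + 2 * mean_swaps n"
    using step.IH by simp
  have mean_Suc: "real (Suc n) * mean_swaps (Suc n) =
      (real n + 1) * (real n + 3) * harm n + (real n + 3) - (real n + 1) * (5 / 2 * real n + 3)"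
    by (simp add: mean_swaps_def harm_Suc field_simps)
  have mean: "mean_swaps n = (real n + 2) * harm n - 5 / 2 * real n - 1 / 2"
    using step.hyps by (simp add: mean_swaps_def)
  have harm: "real (Suc n) * harm (Suc n) = (real n + 1) * harm n + 1"
    by (simp add: harm_Suc field_simps)
  show ?case
    unfolding sum_eq mean_Suc mean harm by (simp add: field_simps)
qed

lemma perm_mean_swap_count:
  fixes A :: "'a::linorder set"
  assumes "finite A"
  shows "perm_mean A (\<lambda>S. real (swap_count S)) = mean_swaps (card A)"
  using assms
proof (induction "card A" arbitrary: A rule: less_induct)
  case less
  show ?case
  proof (cases "A = {}")
    case True
    then show ?thesis by (simp add: mean_swaps_def pmf_of_set_singleton)
  next
    case False
    define n where "n = card A"
    have n: "n \<ge> 1" using False less.prems by (simp add: n_def Suc_le_eq card_gt_0_iff)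
    define rank where "rank = (\<lambda>p. card {x \<in> A. x < p})"
    \<comment> \<open>the mean cost of partitioning with a pivot of rank \<open>k\<close>\<close>
    define w where "w k = real k - real k / (real (n - 1 - k) + 1) + of_bool (n - 1 - k > 0)" for k
    have "real n * perm_mean A (\<lambda>S. real (swap_count S)) =
          (\<Sum>p\<in>A. perm_mean (A - {p}) (\<lambda>xs. real (swap_count (xs @ [p]))))"
      unfolding n_def by (rule perm_mean_snoc[OF less.prems False])
    also have "\<dots> = (\<Sum>p\<in>A. w (rank p) + mean_swaps (rank p) + mean_swaps (n - 1 - rank p))"
    proof (rule sum.cong[OF refl])
      fix p assume p: "p \<in> A"
      have sets: "{x \<in> A - {p}. x < p} = {x \<in> A. x < p}" "{x \<in> A - {p}. p < x} = {x \<in> A. p < x}"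
        by auto
      have fin: "finite (A - {p})" "p \<notin> A - {p}"
        using less.prems by auto
      have large: "card {x \<in> A. p < x} = n - 1 - rank p"
        using card_greater_eq_rank[OF less.prems p] by (simp add: n_def rank_def)
      have "card {x \<in> A. x < p} < card A" "card {x \<in> A. p < x} < card A"
        using less.prems p by (auto intro!: psubset_card_mono)
      then have IH: "perm_mean {x \<in> A. x < p} (\<lambda>S. real (swap_count S)) = mean_swaps (rank p)"
        "perm_mean {x \<in> A. p < x} (\<lambda>S. real (swap_count S)) = mean_swaps (n - 1 - rank p)"
        using less.hyps[of "{x \<in> A. x < p}"] less.hyps[of "{x \<in> A. p < x}"] less.prems large
        by (simp_all add: rank_def)
      show "perm_mean (A - {p}) (\<lambda>xs. real (swap_count (xs @ [p]))) =
            w (rank p) + mean_swaps (rank p) + mean_swaps (n - 1 - rank p)"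
        unfolding perm_mean_swap_count_snoc[OF fin] perm_mean_partition_swaps[OF fin]
          sets IH w_def large by (simp add: rank_def)
    qed
    also have "\<dots> = (\<Sum>k<n. w k + mean_swaps k + mean_swaps (n - 1 - k))"
      using bij_betw_rank[OF less.prems] unfolding rank_def n_def
      by (rule sum.reindex_bij_betw)
    also have "\<dots> = (\<Sum>k<n. w k) + 2 * (\<Sum>k<n. mean_swaps k)"
      using sum.nat_diff_reindex[of mean_swaps n] by (simp add: sum.distrib)
    also have "\<dots> = real n * mean_swaps n"
      unfolding w_def sum_partition_swaps[OF n] mean_swaps_recurrence[OF n] ..
    finally show ?thesis
      using n by (simp add: n_def)
  qed
qed

theorem theorem4p16:
  fixes A :: "'a::linorder set" and n :: nat
  assumes "n \<ge> 1" and "finite A" and "card A = n"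
  shows "measure_pmf.expectation (pmf_of_set (permutations_of_set A)) (\<lambda>S. real (swap_count S))
           = (real n + 2) * harm n - 5 / 2 * real n - 1 / 2"
  using assms by (simp add: perm_mean_swap_count mean_swaps_def)

end
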